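(* Let $f:\mathbb{R}^n\to\overline{\mathbb{R}}$ be proper, lower semicontinuous and prox-bounded with threshold $\lambda_f\in(0,\infty]$. Then for every $\lambda\in(0,\lambda_f)$, $$P_\lambda f=(\operatorname{Id}+\lambda\,\partial f)^{-1}\quad\Longleftrightarrow\quad f+\frac{1}{2\lambda}\|\cdot\|^2\ \text{ is convex},$$ where the left-hand side is an equality of set-valued operators from $\mathbb{R}^n$ to $2^{\mathbb{R}^n}$, $P_\lambda f$ is the proximal mapping of $f$ with parameter $\lambda$, and $\partial f$ is the Mordukhovich limiting subdifferential of $f$.
   Context: $\mathbb{R}^n$ carries the standard inner product $\langle\cdot,\cdot\rangle$ and norm $\|\cdot\|$; $\overline{\mathbb{R}}=\mathbb{R}\cup\{\pm\infty\}$. A function $f:\mathbb{R}^n\to\overline{\mathbb{R}}$ is proper if $f>-\infty$ everywhere and $\operatorname{dom} f=\{x: f(x)<\infty\}$ is nonempty. A proper lower semicontinuous $f$ is prox-bounded if there is $\lambda>0$ such that $f+\frac{1}{2\lambda}\|\cdot\|^2$ is bounded below; the supremum of all such $\lambda$ is the threshold $\lambda_f$. Proximal mapping: $P_\lambda f(x)=\operatorname{argmin}_{y\in\mathbb{R}^n}\{f(y)+\frac{1}{2\lambda}\|y-x\|^2\}$. Fréchet subgradient: for $\bar x\in\operatorname{dom} f$, $v\in\hat\partial f(\bar x)$ if $f(x)\ge f(\bar x)+\langle v,x-\bar x\rangle+o(\|x-\bar x\|)$ as $x\to\bar x$. Limiting subgradient: for $\bar x\in\operatorname{dom} f$, $v\in\partial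 f(\bar x)$ if there exist $x_k\to\bar x$ with $f(x_k)\to f(\bar x)$ and $v_k\in\hat\partial f(x_k)$ with $v_k\to v$. Both are empty at points outside $\operatorname{dom} f$. For a set-valued operator $A$, $x^*\in(\operatorname{Id}+\lambda A)^{-1}(x)$ means $x\in x^*+\lambda A(x^* )$. *)

theory Defs
  imports "HOL-Analysis.Analysis" "HOL-Library.Landau_Symbols"
begin

definition effective_dom :: "('a \<Rightarrow> ereal) \<Rightarrow> 'a set" where
  "effective_dom f = {x. f x < \<infinity>}"

definition proper_fun :: "('a \<Rightarrow> ereal) \<Rightarrow> bool" where
  "proper_fun f \<longleftrightarrow> (\<forall>x. - \<infinity> < f x) \<and> effective_dom f \<noteq> {}"

definition lower_semicontinuous :: "('a::topological_space \<Rightarrow> ereal) \<Rightarrow> bool" where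
  "lower_semicontinuous f \<longleftrightarrow> (\<forall>x. f x \<le> Liminf (at x) f)"

text \<open>In \<^typ>\<open>ereal\<close>, \<open>\<infinity> + (- \<infinity>) = \<infinity>\<close>, so the inequality below is the usual definition
  (inf-addition convention) even for functions taking the value \<open>- \<infinity>\<close>.\<close>

definition convex_ereal :: "('a::real_vector \<Rightarrow> ereal) \<Rightarrow> bool" where
  "convex_ereal f \<longleftrightarrow>
     (\<forall>x y. \<forall>t::real. 0 < t \<longrightarrow> t < 1 \<longrightarrow>
        f ((1 - t) *\<^sub>R x + t *\<^sub>R y) \<le> ereal (1 - t) * f x + ereal t * f y)"

definition add_quadratic :: "real \<Rightarrow> ('a::real_normed_vector \<Rightarrow> ereal) \<Rightarrow> 'a \<Rightarrow> ereal" where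
  "add_quadratic lam f = (\<lambda>x. f x + ereal (1 / (2 * lam) * (norm x)\<^sup>2))"

text \<open>Every set of extended reals has the lower bound \<open>- \<infinity>\<close>, hence \<^const>\<open>bdd_below\<close> is
  trivial here and the lower bound must be required to be a real number.\<close>

definition bounded_below :: "('a \<Rightarrow> ereal) \<Rightarrow> bool" where
  "bounded_below g \<longleftrightarrow> (\<exists>c::real. \<forall>x. ereal c \<le> g x)"

definition prox_bounded :: "('a::real_normed_vector \<Rightarrow> ereal) \<Rightarrow> bool" where
  "prox_bounded f \<longleftrightarrow> (\<exists>lam>0. bounded_below (add_quadratic lam f))"

definition prox_threshold :: "('a::real_normed_vector \<Rightarrow> ereal) \<Rightarrow> ereal" where
  "prox_threshold f = Sup {ereal lam | lam. 0 < lam \<and> bounded_below (add_quadratic lam f)}"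

definition prox :: "real \<Rightarrow> ('a::real_normed_vector \<Rightarrow> ereal) \<Rightarrow> 'a \<Rightarrow> 'a set" where
  "prox lam f x =
     {y. is_arg_min (\<lambda>z. f z + ereal (1 / (2 * lam) * (norm (z - x))\<^sup>2)) (\<lambda>_. True) y}"

definition frechet_subdifferential :: "('a::real_inner \<Rightarrow> ereal) \<Rightarrow> 'a \<Rightarrow> 'a set" where
  "frechet_subdifferential f x0 =
     {v. x0 \<in> effective_dom f \<and>
         (\<exists>r :: 'a \<Rightarrow> real. r \<in> o[at x0](\<lambda>x. norm (x - x0)) \<and>
            (\<forall>\<^sub>F x in at x0. f x \<ge> f x0 + ereal (v \<bullet> (x - x0)) + ereal (r x)))}"

definition limiting_subdifferential :: "('a::real_inner \<Rightarrow> ereal) \<Rightarrow> 'a \<Rightarrow> 'a set" where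
  "limiting_subdifferential f x0 =
     {v. x0 \<in> effective_dom f \<and>
         (\<exists>(xs :: nat \<Rightarrow> 'a) (vs :: nat \<Rightarrow> 'a).
            xs \<longlonglongrightarrow> x0 \<and> (\<lambda>k. f (xs k)) \<longlonglongrightarrow> f x0 \<and>
            (\<forall>k. vs k \<in> frechet_subdifferential f (xs k)) \<and> vs \<longlonglongrightarrow> v)}"

text \<open>\<open>resolvent lam A\<close> is the set-valued operator \<open>(Id + lam A)\<close> inverse.\<close>

definition resolvent :: "real \<Rightarrow> ('a::real_vector \<Rightarrow> 'a set) \<Rightarrow> 'a \<Rightarrow> 'a set" where
  "resolvent lam A x = {y. x \<in> {y + lam *\<^sub>R v | v. v \<in> A y}}"

end

theory Submission
  imports Defs
begin

text \<open>
  Put \<open>g = f + (1/(2\<lambda>))\<parallel>\<cdot>\<parallel>\<^sup>2\<close>. Expanding the square shows that \<open>y \<in> P\<^sub>\<lambda> f x\<close> says exactly that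
  \<open>x/\<lambda>\<close> is a subgradient of \<open>g\<close> at \<open>y\<close> in the global sense of convex analysis
  (\<open>prox_iff_convex_subgradient\<close>), while the sum rule for a smooth summand shows that
  \<open>y \<in> (Id + \<lambda>\<partial>f)\<inverse> x\<close> says that \<open>x/\<lambda>\<close> is a limiting subgradient of \<open>g\<close> at \<open>y\<close>
  (\<open>resolvent_iff_limiting_subgradient\<close>). So the claim is that the limiting subgradients of \<open>g\<close>
  are precisely its global subgradients if and only if \<open>g\<close> is convex.

  If \<open>g\<close> is convex, a Frechet subgradient is global because difference quotients along a
  segment are monotone, and the global inequality survives the limits that define \<open>\<partial>g\<close>.

  For the converse let \<open>m = (1 - t)a + tb\<close>. Since \<open>\<lambda> < \<lambda>\<^sub>f\<close>, the function \<open>g\<close> is bounded below, so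
  \<open>g + s\<parallel>\<cdot> - m\<parallel>\<^sup>2\<close> has a minimiser \<open>y\<close> for each \<open>s > 0\<close>, and \<open>w = 2s(m - y)\<close> is a Frechet
  subgradient of \<open>g\<close> at \<open>y\<close>. By hypothesis it is global. Averaging its inequalities at \<open>a\<close> and \<open>b\<close>
  gives
  \<open>(1 - t)g(a) + tg(b) \<ge> g(y) + w \<bullet> (m - y) = g(y) + 2s\<parallel>m - y\<parallel>\<^sup>2\<close>.
  Because \<open>g\<close> is bounded below, this forces \<open>y \<rightarrow> m\<close> as \<open>s \<rightarrow> \<infinity>\<close>, and lower semicontinuity yields
  \<open>g(m) \<le> (1 - t)g(a) + tg(b)\<close> (\<open>convex_if_frechet_subgradients_global\<close>).
\<close>

section \<open>Lower semicontinuous functions and existence of minimisers\<close>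

lemma lower_semicontinuous_eventually_greater:
  assumes "lower_semicontinuous f" and "c < f x"
  shows "\<forall>\<^sub>F z in nhds x. c < f z"
proof -
  have "c < Liminf (at x) f"
    using assms unfolding lower_semicontinuous_def by (meson less_le_trans)
  then have "\<forall>\<^sub>F z in at x. c < f z"
    by (rule less_LiminfD)
  with assms(2) show ?thesis
    by (auto simp: eventually_at_filter elim: eventually_mono)
qed

lemma lower_semicontinuous_open_superlevel:
  assumes "lower_semicontinuous f"
  shows "open {z. c < f z}"
  unfolding open_subopen[of "{z. c < f z}"]
  using lower_semicontinuous_eventually_greater[OF assms, of c]
  by (fastforce simp: eventually_nhds)

lemma lower_semicontinuous_add_continuous:
  fixes f :: "'a::topological_space \<Rightarrow> ereal" and \<phi> :: "'a \<Rightarrow> real"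
  assumes lsc: "lower_semicontinuous f" and cont: "continuous_on UNIV \<phi>"
  shows "lower_semicontinuous (\<lambda>x. f x + ereal (\<phi> x))"
  unfolding lower_semicontinuous_def le_Liminf_iff
proof (intro allI impI)
  fix x c assume "c < f x + ereal (\<phi> x)"
  then have "c - ereal (\<phi> x) < f x"
    by (cases c; cases "f x") auto
  then obtain d where d: "c - ereal (\<phi> x) < ereal d" "ereal d < f x"
    using ereal_dense2 by blast
  have "\<forall>\<^sub>F z in at x. ereal d < f z"
    using lower_semicontinuous_eventually_greater[OF lsc d(2)]
    by (simp add: eventually_nhds_conv_at)
  moreover have "\<forall>\<^sub>F z in at x. c < ereal d + ereal (\<phi> z)"
  proof -
    have "((\<lambda>z. ereal (d + \<phi> z)) \<longlongrightarrow> ereal (d + \<phi> x)) (at x)"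
      using cont by (auto intro!: tendsto_intros simp: continuous_on_def)
    moreover have "c < ereal (d + \<phi> x)"
      using d(1) by (cases c) auto
    ultimately have "\<forall>\<^sub>F z in at x. c < ereal (d + \<phi> z)"
      by (rule order_tendstoD(1))
    then show ?thesis by simp
  qed
  ultimately show "\<forall>\<^sub>F z in at x. c < f z + ereal (\<phi> z)"
  proof eventually_elim
    case (elim z)
    then show ?case
      by (metis add_right_mono less_imp_le less_le_trans)
  qed
qed

text \<open>If no point of \<open>K\<close> were a minimiser, the open sets \<open>{y. f z < f y}\<close> with \<open>z \<in> K\<close> would cover
  \<open>K\<close>, and the best of the finitely many \<open>z\<close> in a subcover would not be covered.\<close>

lemma lower_semicontinuous_attains_inf:
  assumes lsc: "lower_semicontinuous f" and "compact K" and "K \<noteq> {}"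
  obtains y where "y \<in> K" and "\<And>z. z \<in> K \<Longrightarrow> f y \<le> f z"
proof (rule ccontr)
  assume "\<not> thesis"
  then have "\<forall>y\<in>K. \<exists>z\<in>K. f z < f y"
    using that by (meson not_le)
  then have "K \<subseteq> (\<Union>z\<in>K. {y. f z < f y})"
    by blast
  then obtain Z where Z: "Z \<subseteq> K" "finite Z" "K \<subseteq> (\<Union>z\<in>Z. {y. f z < f y})"
    using compactE_image[OF \<open>compact K\<close>, of K "\<lambda>z. {y. f z < f y}"]
      lower_semicontinuous_open_superlevel[OF lsc] by metis
  then have "Z \<noteq> {}"
    using \<open>K \<noteq> {}\<close> by auto
  then obtain z where "z \<in> Z" "\<And>z'. z' \<in> Z \<Longrightarrow> f z \<le> f z'"
    using Z(2) by (metis arg_min_if_finite(1) arg_min_least)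
  with Z show False
    by (metis (no_types, lifting) UN_E leD mem_Collect_eq subsetD)
qed

text \<open>As \<open>g\<close> is bounded below, the quadratic term lifts the sum above its value at a given point of the
  domain outside a large ball around \<open>m\<close>, so minimising over that ball suffices.\<close>

lemma exists_minimiser_add_square_distance:
  fixes g :: "'a::euclidean_space \<Rightarrow> ereal"
  assumes "proper_fun g" and lsc: "lower_semicontinuous g" and "bounded_below g" and "0 < s"
  obtains y where "y \<in> effective_dom g"
    and "\<And>z. g y + ereal (s * (norm (y - m))\<^sup>2) \<le> g z + ereal (s * (norm (z - m))\<^sup>2)"
proof -
  define h where "h = (\<lambda>z. g z + ereal (s * (norm (z - m))\<^sup>2))"
  obtain c where c: "\<And>z. ereal c \<le> g z"
    using \<open>bounded_below g\<close> unfolding bounded_below_def by blast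
  obtain a A where A: "g a = ereal A"
  proof -
    obtain a where "g a < \<infinity>" "- \<infinity> < g a"
      using \<open>proper_fun g\<close> unfolding proper_fun_def effective_dom_def by auto
    then show ?thesis
      using that by (cases "g a") auto
  qed
  define H where "H = A + s * (norm (a - m))\<^sup>2"
  have "c \<le> A"
    using c[of a] A by simp
  define R where "R = sqrt ((H - c) / s)"
  have "(norm (a - m))\<^sup>2 \<le> (H - c) / s"
    using \<open>c \<le> A\<close> \<open>0 < s\<close> by (simp add: H_def field_simps)
  then have "norm (a - m) \<le> R"
    unfolding R_def by (rule real_le_rsqrt)
  then have a: "a \<in> cball m R"
    by (simp add: dist_norm norm_minus_commute)
  have "lower_semicontinuous h"
    unfolding h_def by (intro lower_semicontinuous_add_continuous lsc continuous_intros)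
  then obtain y where y: "\<And>z. z \<in> cball m R \<Longrightarrow> h y \<le> h z"
    using lower_semicontinuous_attains_inf[of h "cball m R"] a
    by (metis compact_cball empty_iff)
  have ya: "h y \<le> ereal H"
    using y[OF a] by (simp add: h_def H_def A)
  have "h y \<le> h z" for z
  proof (cases "z \<in> cball m R")
    case False
    then have "R < norm (z - m)"
      by (simp add: dist_norm norm_minus_commute)
    then have "(H - c) / s < (norm (z - m))\<^sup>2"
      unfolding R_def using \<open>0 < s\<close> by (metis norm_ge_zero real_less_rsqrt real_sqrt_less_iff real_sqrt_unique not_less_iff_gr_or_eq)
    then have "H \<le> c + s * (norm (z - m))\<^sup>2"
      using \<open>0 < s\<close> by (simp add: field_simps)
    then have "ereal H \<le> ereal c + ereal (s * (norm (z - m))\<^sup>2)"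
      by simp
    also have "\<dots> \<le> h z"
      unfolding h_def by (intro add_right_mono c)
    finally show ?thesis
      using ya by simp
  qed (rule y)
  moreover have "y \<in> effective_dom g"
    using ya unfolding h_def effective_dom_def by (cases "g y") auto
  ultimately show thesis
    using that unfolding h_def by blast
qed

section \<open>Frechet, limiting and global subgradients\<close>

definition convex_subdifferential :: "('a::real_inner \<Rightarrow> ereal) \<Rightarrow> 'a \<Rightarrow> 'a set" where
  "convex_subdifferential g y =
     {w. y \<in> effective_dom g \<and> (\<forall>z. g y + ereal (w \<bullet> (z - y)) \<le> g z)}"

lemma frechet_subset_limiting_subdifferential:
  "frechet_subdifferential g y \<subseteq> limiting_subdifferential g y"
proof
  fix v assume "v \<in> frechet_subdifferential g y"
  then show "v \<in> limiting_subdifferential g y"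
    unfolding limiting_subdifferential_def
    by (intro CollectI conjI exI[of _ "\<lambda>_. y"] exI[of _ "\<lambda>_. v"])
      (auto simp: frechet_subdifferential_def)
qed

lemma convex_subset_frechet_subdifferential:
  "convex_subdifferential g y \<subseteq> frechet_subdifferential g y"
  unfolding convex_subdifferential_def frechet_subdifferential_def
  by (auto intro!: exI[of _ "\<lambda>_. 0"])

lemma square_distance_smallo:
  fixes y :: "'a::real_normed_vector"
  shows "(\<lambda>z. c * (norm (z - y))\<^sup>2) \<in> o[at y](\<lambda>z. norm (z - y))"
proof (rule smalloI_tendsto)
  have "((\<lambda>z. c * norm (z - y)) \<longlongrightarrow> c * norm (y - y)) (at y)"
    by (intro tendsto_intros)
  moreover have "(\<lambda>z. c * (norm (z - y))\<^sup>2 / norm (z - y)) = (\<lambda>z. c * norm (z - y))"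
    by (auto simp: power2_eq_square)
  ultimately show "((\<lambda>z. c * (norm (z - y))\<^sup>2 / norm (z - y)) \<longlongrightarrow> 0) (at y)"
    by simp
  show "\<forall>\<^sub>F z in at y. norm (z - y) \<noteq> 0"
    by (simp add: eventually_at_filter)
qed

text \<open>A minimiser of \<open>g\<close> plus a smooth function has minus the gradient of that function as a
  Frechet subgradient of \<open>g\<close>; for a squared distance the error term is again a square.\<close>

lemma minimiser_frechet_subgradient:
  fixes g :: "'a::real_inner \<Rightarrow> ereal"
  assumes "y \<in> effective_dom g"
    and min: "\<And>z. g y + ereal (s * (norm (y - m))\<^sup>2) \<le> g z + ereal (s * (norm (z - m))\<^sup>2)"
  shows "(2 * s) *\<^sub>R (m - y) \<in> frechet_subdifferential g y"
proof -
  have "g y + ereal (((2 * s) *\<^sub>R (m - y)) \<bullet> (z - y)) + ereal (- s * (norm (z - y))\<^sup>2) \<le> g z"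
    for z
  proof -
    have "s * (norm (y - m))\<^sup>2 - s * (norm (z - m))\<^sup>2
        = ((2 * s) *\<^sub>R (m - y)) \<bullet> (z - y) + - s * (norm (z - y))\<^sup>2"
      by (simp add: power2_norm_eq_inner inner_diff_left inner_diff_right inner_commute algebra_simps)
    with min[of z] show ?thesis
      by (cases "g y"; cases "g z") auto
  qed
  then show ?thesis
    using assms(1) square_distance_smallo[of "- s" y]
    unfolding frechet_subdifferential_def
    by (intro CollectI conjI exI[of _ "\<lambda>z. - s * (norm (z - y))\<^sup>2"] always_eventually allI)
qed

lemma frechet_subgradient_add_quadratic:
  fixes f :: "'a::real_inner \<Rightarrow> ereal"
  assumes "v \<in> frechet_subdifferential f y"
  shows "v + (1 / lam) *\<^sub>R y \<in> frechet_subdifferential (add_quadratic lam f) y"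
proof -
  define q where "q = 1 / (2 * lam)"
  have q: "1 / lam = 2 * q" by (simp add: q_def)
  obtain r where r: "r \<in> o[at y](\<lambda>x. norm (x - y))"
    and ev: "\<forall>\<^sub>F x in at y. f x \<ge> f y + ereal (v \<bullet> (x - y)) + ereal (r x)"
    and dom: "y \<in> effective_dom f"
    using assms unfolding frechet_subdifferential_def by auto
  let ?r = "\<lambda>x. r x + q * (norm (x - y))\<^sup>2"
  have "?r \<in> o[at y](\<lambda>x. norm (x - y))"
    by (intro sum_in_smallo r square_distance_smallo)
  moreover have "\<forall>\<^sub>F x in at y. add_quadratic lam f x
      \<ge> add_quadratic lam f y + ereal ((v + (1 / lam) *\<^sub>R y) \<bullet> (x - y)) + ereal (?r x)"
    using ev
  proof eventually_elim
    case (elim x)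
    have "q * (norm x)\<^sup>2 = q * (norm y)\<^sup>2 + ((2 * q) *\<^sub>R y) \<bullet> (x - y) + q * (norm (x - y))\<^sup>2"
      by (simp add: power2_norm_eq_inner inner_diff_left inner_diff_right inner_commute algebra_simps)
    with elim show ?case
      unfolding add_quadratic_def q_def[symmetric] q
      by (cases "f x"; cases "f y") (auto simp: inner_add_left)
  qed
  moreover have "y \<in> effective_dom (add_quadratic lam f)"
    using dom by (cases "f y") (auto simp: effective_dom_def add_quadratic_def)
  ultimately show ?thesis
    unfolding frechet_subdifferential_def by blast
qed

lemma limiting_subgradient_add_quadratic:
  fixes f :: "'a::real_inner \<Rightarrow> ereal"
  assumes "v \<in> limiting_subdifferential f y"
  shows "v + (1 / lam) *\<^sub>R y \<in> limiting_subdifferential (add_quadratic lam f) y"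
proof -
  obtain xs vs where dom: "y \<in> effective_dom f" and xs: "xs \<longlonglongrightarrow> y"
    and fxs: "(\<lambda>k. f (xs k)) \<longlonglongrightarrow> f y"
    and vs: "\<And>k. vs k \<in> frechet_subdifferential f (xs k)" "vs \<longlonglongrightarrow> v"
    using assms unfolding limiting_subdifferential_def by auto
  have "(\<lambda>k. add_quadratic lam f (xs k)) \<longlonglongrightarrow> add_quadratic lam f y"
    unfolding add_quadratic_def
    by (intro tendsto_add_ereal_general1 fxs tendsto_intros xs) auto
  moreover have "(\<lambda>k. vs k + (1 / lam) *\<^sub>R xs k) \<longlonglongrightarrow> v + (1 / lam) *\<^sub>R y"
    by (intro tendsto_intros vs xs)
  moreover have "y \<in> effective_dom (add_quadratic lam f)"
    using dom by (cases "f y") (auto simp: effective_dom_def add_quadratic_def)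
  ultimately show ?thesis
    unfolding limiting_subdifferential_def
    using xs frechet_subgradient_add_quadratic[OF vs(1)]
    by (intro CollectI conjI exI[of _ xs] exI[of _ "\<lambda>k. vs k + (1 / lam) *\<^sub>R xs k"]) auto
qed

text \<open>The quadratic with parameter \<open>- lam\<close> cancels the one with parameter \<open>lam\<close>, so the sum rule is
  its own converse.\<close>

lemma limiting_subgradient_add_quadratic_iff:
  fixes f :: "'a::real_inner \<Rightarrow> ereal"
  shows "v + (1 / lam) *\<^sub>R y \<in> limiting_subdifferential (add_quadratic lam f) y
    \<longleftrightarrow> v \<in> limiting_subdifferential f y"
proof -
  have "add_quadratic (- lam) (add_quadratic lam f) z = f z" for z
    by (cases "f z") (auto simp: add_quadratic_def)
  then have "add_quadratic (- lam) (add_quadratic lam f) = f" ..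
  then show ?thesis
    using limiting_subgradient_add_quadratic[of v f y lam]
      limiting_subgradient_add_quadratic[of "v + (1 / lam) *\<^sub>R y" "add_quadratic lam f" y "- lam"]
    by auto
qed

section \<open>Convexity and global subgradients\<close>

text \<open>Convexity bounds \<open>g\<close> at the point a fraction \<open>t\<close> of the way from \<open>y\<close> to \<open>z\<close> from above, the
  subgradient bounds it from below; dividing by \<open>t \<rightarrow> 0\<close> leaves the subgradient inequality at \<open>z\<close>.\<close>

lemma convex_frechet_subgradient_global:
  fixes g :: "'a::real_inner \<Rightarrow> ereal"
  assumes "proper_fun g" and conv: "convex_ereal g" and v: "v \<in> frechet_subdifferential g y"
  shows "v \<in> convex_subdifferential g y"
proof -
  have dom: "y \<in> effective_dom g"
    using v by (simp add: frechet_subdifferential_def)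
  obtain r where r: "r \<in> o[at y](\<lambda>x. norm (x - y))"
    and ev: "\<forall>\<^sub>F x in at y. g x \<ge> g y + ereal (v \<bullet> (x - y)) + ereal (r x)"
    using v unfolding frechet_subdifferential_def by auto
  obtain G where G: "g y = ereal G"
    using dom \<open>proper_fun g\<close> unfolding proper_fun_def effective_dom_def
    by (cases "g y") (auto dest: spec[of _ y])
  have "g y + ereal (v \<bullet> (z - y)) \<le> g z" for z
  proof (cases "z = y \<or> g z = \<infinity>")
    case False
    then have "z \<noteq> y" by simp
    obtain Z where Z: "g z = ereal Z"
      using False \<open>proper_fun g\<close> unfolding proper_fun_def
      by (cases "g z") (auto dest: spec[of _ z])
    let ?d = "z - y"
    have "G + v \<bullet> ?d \<le> Z"
    proof (rule field_le_epsilon)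
      fix e :: real assume "0 < e"
      then have "0 < e / norm ?d"
        using \<open>z \<noteq> y\<close> by simp
      then have "\<forall>\<^sub>F x in at y. norm (r x) \<le> e / norm ?d * norm (norm (x - y))"
        using landau_o.smallD[OF r] by blast
      let ?P = "\<lambda>x. g x \<ge> g y + ereal (v \<bullet> (x - y)) + ereal (r x)
          \<and> \<bar>r x\<bar> \<le> e / norm ?d * norm (x - y)"
      have "\<forall>\<^sub>F x in at y. ?P x"
        using ev \<open>\<forall>\<^sub>F x in at y. norm (r x) \<le> _\<close> by eventually_elim simp
      moreover have "filterlim (\<lambda>t. y + t *\<^sub>R ?d) (at y) (at_right 0)"
      proof (rule filterlim_atI)
        have "((\<lambda>t. y + t *\<^sub>R ?d) \<longlongrightarrow> y + 0 *\<^sub>R ?d) (at_right 0)"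
          by (intro tendsto_intros)
        then show "((\<lambda>t. y + t *\<^sub>R ?d) \<longlongrightarrow> y) (at_right 0)"
          by simp
        show "\<forall>\<^sub>F t in at_right 0. y + t *\<^sub>R ?d \<noteq> y"
          using \<open>z \<noteq> y\<close> by (simp add: eventually_at_filter)
      qed
      ultimately have "\<forall>\<^sub>F t in at_right 0. ?P (y + t *\<^sub>R ?d)"
        by (rule eventually_compose_filterlim)
      moreover have "\<forall>\<^sub>F t in at_right (0::real). 0 < t \<and> t < 1"
        using eventually_at_right_real[of 0 1] by simp
      ultimately have "\<forall>\<^sub>F t in at_right (0::real). 0 < t \<and> t < 1 \<and> ?P (y + t *\<^sub>R ?d)"
        by eventually_elim blast
      then obtain t where t: "0 < t" "t < 1" and P: "?P (y + t *\<^sub>R ?d)"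
        by (metis (no_types, lifting) eventually_happens trivial_limit_at_right_real)
      have lower: "g (y + t *\<^sub>R ?d) \<ge> g y + ereal (v \<bullet> (t *\<^sub>R ?d)) + ereal (r (y + t *\<^sub>R ?d))"
        and small: "\<bar>r (y + t *\<^sub>R ?d)\<bar> \<le> e / norm ?d * norm (t *\<^sub>R ?d)"
        using P by (simp_all only: add_diff_cancel_left')
      have "y + t *\<^sub>R ?d = (1 - t) *\<^sub>R y + t *\<^sub>R z"
        by (simp add: algebra_simps)
      then have "g (y + t *\<^sub>R ?d) \<le> ereal (1 - t) * g y + ereal t * g z"
        using conv t unfolding convex_ereal_def by metis
      with lower have "G + v \<bullet> (t *\<^sub>R ?d) + r (y + t *\<^sub>R ?d) \<le> (1 - t) * G + t * Z"
        by (cases "g (y + t *\<^sub>R ?d)") (auto simp: G Z)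
      moreover have "- (t * e) \<le> r (y + t *\<^sub>R ?d)"
        using small t \<open>z \<noteq> y\<close> by (simp add: abs_le_iff mult.commute)
      ultimately have "t * (G + v \<bullet> ?d) \<le> t * (Z + e)"
        by (simp add: algebra_simps)
      then show "G + v \<bullet> ?d \<le> Z + e"
        using t by simp
    qed
    then show ?thesis
      by (simp add: G Z)
  qed auto
  then show ?thesis
    unfolding convex_subdifferential_def using dom by blast
qed

lemma convex_limiting_eq_convex_subdifferential:
  fixes g :: "'a::real_inner \<Rightarrow> ereal"
  assumes "proper_fun g" and "convex_ereal g"
  shows "limiting_subdifferential g y = convex_subdifferential g y"
proof
  show "convex_subdifferential g y \<subseteq> limiting_subdifferential g y"
    using convex_subset_frechet_subdifferential frechet_subset_limiting_subdifferential by blast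
  show "limiting_subdifferential g y \<subseteq> convex_subdifferential g y"
  proof
    fix v assume "v \<in> limiting_subdifferential g y"
    then obtain xs vs where dom: "y \<in> effective_dom g" and xs: "xs \<longlonglongrightarrow> y"
      and gxs: "(\<lambda>k. g (xs k)) \<longlonglongrightarrow> g y"
      and vs: "\<And>k. vs k \<in> frechet_subdifferential g (xs k)" "vs \<longlonglongrightarrow> v"
      unfolding limiting_subdifferential_def by auto
    have "g y + ereal (v \<bullet> (z - y)) \<le> g z" for z
    proof (rule LIMSEQ_le_const2)
      show "(\<lambda>k. g (xs k) + ereal (vs k \<bullet> (z - xs k))) \<longlonglongrightarrow> g y + ereal (v \<bullet> (z - y))"
        by (intro tendsto_add_ereal_general1 gxs tendsto_intros vs xs) auto
      show "\<exists>N. \<forall>k\<ge>N. g (xs k) + ereal (vs k \<bullet> (z - xs k)) \<le> g z"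
        using convex_frechet_subgradient_global[OF assms vs(1)]
        by (simp add: convex_subdifferential_def)
    qed
    then show "v \<in> convex_subdifferential g y"
      unfolding convex_subdifferential_def using dom by blast
  qed
qed

text \<open>Argued by contradiction: if \<open>g m\<close> exceeded the average \<open>K\<close> of \<open>g a\<close> and \<open>g b\<close>, lower
  semicontinuity would keep \<open>g\<close> above \<open>K\<close> on a ball around \<open>m\<close>. A minimiser of \<open>g\<close> plus a steep
  quadratic centred at \<open>m\<close> lies in that ball, yet its global subgradient gives it a value of at
  most \<open>K\<close>.\<close>

lemma convex_if_frechet_subgradients_global:
  fixes g :: "'a::euclidean_space \<Rightarrow> ereal"
  assumes is_proper: "proper_fun g" and lsc: "lower_semicontinuous g" and bdd: "bounded_below g"
    and frechet_global: "\<And>y. frechet_subdifferential g y \<subseteq> convex_subdifferential g y"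
  shows "convex_ereal g"
  unfolding convex_ereal_def
proof (intro allI impI)
  fix a b :: 'a and t :: real
  assume t: "0 < t" "t < 1"
  define m where "m = (1 - t) *\<^sub>R a + t *\<^sub>R b"
  have ninf: "g z \<noteq> - \<infinity>" for z
    using is_proper unfolding proper_fun_def by (metis less_irrefl)
  show "g m \<le> ereal (1 - t) * g a + ereal t * g b"
  proof (cases "g a = \<infinity> \<or> g b = \<infinity>")
    case True
    then have "ereal (1 - t) * g a + ereal t * g b = \<infinity>"
      using t ninf[of a] ninf[of b] by (cases "g a"; cases "g b") auto
    then show ?thesis by (simp only: ereal_less_eq)
  next
    case False
    then obtain A B where A: "g a = ereal A" and B: "g b = ereal B"
      using ninf by (metis ereal_cases)
    obtain c where c: "\<And>z. ereal c \<le> g z"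
      using bdd unfolding bounded_below_def by blast
    define K where "K = (1 - t) * A + t * B"
    have "c \<le> A" "c \<le> B"
      using c[of a] c[of b] by (simp_all add: A B)
    then have "(1 - t) * c + t * c \<le> K"
      unfolding K_def using t by (intro add_mono mult_left_mono) auto
    then have "c \<le> K"
      by (simp add: algebra_simps)
    have "g m \<le> ereal K"
    proof (rule ccontr)
      assume "\<not> g m \<le> ereal K"
      then have "\<forall>\<^sub>F z in nhds m. ereal K < g z"
        using lower_semicontinuous_eventually_greater[OF lsc] by simp
      then obtain d where d: "0 < d" "\<And>z. dist z m < d \<Longrightarrow> ereal K < g z"
        unfolding eventually_nhds_metric by blast
      \<comment> \<open>The inequality \<open>YK\<close> bounds \<open>s\<parallel>y - m\<parallel>\<^sup>2\<close> by \<open>K - c\<close>, so this \<open>s\<close> forces \<open>\<parallel>y - m\<parallel> < d\<close>;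
        adding \<open>1\<close> keeps \<open>s\<close> positive when \<open>K = c\<close>.\<close>
      define s where "s = (K - c + 1) / d\<^sup>2"
      have "0 < s"
        using \<open>c \<le> K\<close> d(1) by (simp add: s_def)
      then obtain y where y: "y \<in> effective_dom g"
        "\<And>z. g y + ereal (s * (norm (y - m))\<^sup>2) \<le> g z + ereal (s * (norm (z - m))\<^sup>2)"
        using exists_minimiser_add_square_distance[OF is_proper lsc bdd] by metis
      define w where "w = (2 * s) *\<^sub>R (m - y)"
      have w: "g y + ereal (w \<bullet> (z - y)) \<le> g z" for z
        using minimiser_frechet_subgradient[OF y] frechet_global
        unfolding w_def convex_subdifferential_def by blast
      obtain Y where Y: "g y = ereal Y"
        using y(1) ninf[of y] unfolding effective_dom_def by (cases "g y") auto
      have "Y + w \<bullet> (a - y) \<le> A" "Y + w \<bullet> (b - y) \<le> B"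
        using w[of a] w[of b] by (simp_all add: A B Y)
      then have "(1 - t) * (Y + w \<bullet> (a - y)) + t * (Y + w \<bullet> (b - y)) \<le> K"
        unfolding K_def using t by (intro add_mono mult_left_mono) auto
      moreover have "(1 - t) * (Y + w \<bullet> (a - y)) + t * (Y + w \<bullet> (b - y)) = Y + w \<bullet> (m - y)"
        unfolding m_def by (simp add: inner_diff_right inner_add_right algebra_simps)
      moreover have "w \<bullet> (m - y) = 2 * (s * (norm (y - m))\<^sup>2)"
        unfolding w_def by (simp add: power2_norm_eq_inner[symmetric] norm_minus_commute)
      ultimately have YK: "Y + 2 * (s * (norm (y - m))\<^sup>2) \<le> K"
        by simp
      have pos: "0 \<le> s * (norm (y - m))\<^sup>2"
        using \<open>0 < s\<close> by simp
      have "c \<le> Y"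
        using c[of y] by (simp add: Y)
      then have "s * (norm (y - m))\<^sup>2 < s * d\<^sup>2"
        using YK pos d(1) unfolding s_def by simp
      then have "dist y m < d"
        using \<open>0 < s\<close> d(1) by (simp add: dist_norm power2_less_imp_less)
      then have "ereal K < g y"
        by (rule d(2))
      then show False
        using YK pos by (simp add: Y)
    qed
    then show ?thesis
      by (simp add: A B K_def)
  qed
qed

section \<open>Proximal mapping and resolvent\<close>

lemma proper_add_quadratic:
  assumes "proper_fun f"
  shows "proper_fun (add_quadratic lam f)"
proof -
  have "- \<infinity> < add_quadratic lam f x \<longleftrightarrow> - \<infinity> < f x" "add_quadratic lam f x < \<infinity> \<longleftrightarrow> f x < \<infinity>" for x
    by (cases "f x"; simp add: add_quadratic_def)+
  then show ?thesis
    using assms by (simp add: proper_fun_def effective_dom_def)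
qed

lemma lower_semicontinuous_add_quadratic:
  assumes "lower_semicontinuous f"
  shows "lower_semicontinuous (add_quadratic lam f)"
  unfolding add_quadratic_def
  by (intro lower_semicontinuous_add_continuous assms continuous_intros)

text \<open>The parameter \<open>lam\<close> only has to lie below some admissible \<open>lam'\<close>, because a smaller parameter
  gives a larger quadratic term.\<close>

lemma bounded_below_add_quadratic_below_threshold:
  assumes "0 < lam" and "ereal lam < prox_threshold f"
  shows "bounded_below (add_quadratic lam f)"
proof -
  obtain lam' where lam': "lam < lam'" "bounded_below (add_quadratic lam' f)"
    using assms(2) unfolding prox_threshold_def less_Sup_iff by auto
  then obtain c where c: "\<And>x. ereal c \<le> add_quadratic lam' f x"
    unfolding bounded_below_def by blast
  have "1 / (2 * lam') * (norm x)\<^sup>2 \<le> 1 / (2 * lam) * (norm x)\<^sup>2" for x :: 'a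
    using assms(1) lam'(1) by (intro mult_right_mono) (auto simp: frac_le)
  then have "add_quadratic lam' f x \<le> add_quadratic lam f x" for x
    unfolding add_quadratic_def by (intro add_left_mono) simp
  then show ?thesis
    using c unfolding bounded_below_def by (meson order_trans)
qed

text \<open>Expanding \<open>\<parallel>z - x\<parallel>\<^sup>2\<close> turns the proximal objective into \<open>add_quadratic lam f z\<close> minus the linear
  term \<open>(x / lam) \<bullet> z\<close>, up to a constant; minimising this over \<open>z\<close> is the subgradient inequality.
  Properness of \<open>f\<close> guarantees that a minimiser has a finite value.\<close>

lemma prox_iff_convex_subgradient:
  fixes f :: "'a::real_inner \<Rightarrow> ereal"
  assumes "proper_fun f"
  shows "y \<in> prox lam f x
    \<longleftrightarrow> (1 / lam) *\<^sub>R x \<in> convex_subdifferential (add_quadratic lam f) y"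
proof -
  define q where "q = 1 / (2 * lam)"
  have q: "1 / lam = 2 * q" by (simp add: q_def)
  have step: "f y + ereal (q * (norm (y - x))\<^sup>2) \<le> f z + ereal (q * (norm (z - x))\<^sup>2)
      \<longleftrightarrow> f y + ereal (q * (norm y)\<^sup>2) + ereal (((2 * q) *\<^sub>R x) \<bullet> (z - y)) \<le> f z + ereal (q * (norm z)\<^sup>2)"
    for z
  proof -
    have "q * (norm (z - x))\<^sup>2 - q * (norm (y - x))\<^sup>2
        = q * (norm z)\<^sup>2 - (q * (norm y)\<^sup>2 + ((2 * q) *\<^sub>R x) \<bullet> (z - y))"
      by (simp add: power2_norm_eq_inner inner_diff_left inner_diff_right inner_commute algebra_simps)
    then show ?thesis
      by (cases "f y"; cases "f z") auto
  qed
  have dom: "f y + ereal (q * (norm y)\<^sup>2) < \<infinity>"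
    if min: "\<And>z. f y + ereal (q * (norm (y - x))\<^sup>2) \<le> f z + ereal (q * (norm (z - x))\<^sup>2)"
  proof -
    obtain a where "f a < \<infinity>"
      using assms unfolding proper_fun_def effective_dom_def by auto
    with min[of a] show ?thesis
      by (cases "f y"; cases "f a") auto
  qed
  show ?thesis
    unfolding prox_def is_arg_min_def convex_subdifferential_def effective_dom_def
      add_quadratic_def q_def[symmetric] q
    using step dom by (auto simp: not_less)
qed

lemma resolvent_iff_limiting_subgradient:
  fixes f :: "'a::real_inner \<Rightarrow> ereal"
  assumes "lam \<noteq> 0"
  shows "y \<in> resolvent lam (limiting_subdifferential f) x
    \<longleftrightarrow> (1 / lam) *\<^sub>R x \<in> limiting_subdifferential (add_quadratic lam f) y"
proof -
  have "x = y + lam *\<^sub>R v \<longleftrightarrow> v = (1 / lam) *\<^sub>R (x - y)" for v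
    using assms by auto
  then have "y \<in> resolvent lam (limiting_subdifferential f) x
      \<longleftrightarrow> (1 / lam) *\<^sub>R (x - y) \<in> limiting_subdifferential f y"
    unfolding resolvent_def by auto
  also have "\<dots> \<longleftrightarrow> (1 / lam) *\<^sub>R (x - y) + (1 / lam) *\<^sub>R y
      \<in> limiting_subdifferential (add_quadratic lam f) y"
    by (simp only: limiting_subgradient_add_quadratic_iff)
  finally show ?thesis
    by (simp add: scaleR_diff_right)
qed

theorem theorem3p1:
  fixes f :: "real ^ 'n \<Rightarrow> ereal" and lam :: real
  assumes "proper_fun f"
    and "lower_semicontinuous f"
    and "prox_bounded f"
    and "0 < lam"
    and "ereal lam < prox_threshold f"
  shows "prox lam f = resolvent lam (limiting_subdifferential f)
         \<longleftrightarrow> convex_ereal (add_quadratic lam f)"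
proof -
  define g where "g = add_quadratic lam f"
  have is_proper: "proper_fun g" and lsc: "lower_semicontinuous g" and bdd: "bounded_below g"
    unfolding g_def using assms
    by (simp_all add: proper_add_quadratic lower_semicontinuous_add_quadratic
        bounded_below_add_quadratic_below_threshold)
  have "prox lam f = resolvent lam (limiting_subdifferential f)
      \<longleftrightarrow> (\<forall>x y. (1 / lam) *\<^sub>R x \<in> convex_subdifferential g y
        \<longleftrightarrow> (1 / lam) *\<^sub>R x \<in> limiting_subdifferential g y)"
    using prox_iff_convex_subgradient[OF assms(1), of _ lam]
      resolvent_iff_limiting_subgradient[of lam _ f] \<open>0 < lam\<close>
    unfolding g_def fun_eq_iff set_eq_iff by simp
  also have "\<dots> \<longleftrightarrow> (\<forall>y. limiting_subdifferential g y = convex_subdifferential g y)"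
  proof -
    \<comment> \<open>As \<open>x\<close> ranges over the whole space, so does \<open>x / lam\<close>.\<close>
    have "w = (1 / lam) *\<^sub>R (lam *\<^sub>R w)" for w :: "real ^ 'n"
      using \<open>0 < lam\<close> by simp
    then show ?thesis
      unfolding set_eq_iff by metis
  qed
  also have "\<dots> \<longleftrightarrow> convex_ereal g"
    using convex_limiting_eq_convex_subdifferential[OF is_proper]
      convex_if_frechet_subgradients_global[OF is_proper lsc bdd]
      frechet_subset_limiting_subdifferential[of g] by metis
  finally show ?thesis
    by (simp add: g_def)
qed

end
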